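(* Let $\sigma$ be a fuzzy propositional signature, $F$ a fuzzy formula of $\sigma$, $I$ an interpretation of $\sigma$, and $\mathbf{p},\mathbf{q}$ sets of atoms of $\sigma$, with $\mathbf{q}$ finite in part (b). (a) For any real number $y\in[0,1]$, if $I$ is a $y$-stable model of $F$ relative to $\mathbf{p}\cup\mathbf{q}$, then $I$ is a $y$-stable model of $F$ relative to $\mathbf{p}$. (b) $I$ is a $1$-stable model of $F$ relative to $\mathbf{p}$ if and only if $I$ is a $1$-stable model of $F\otimes\mathbf{q}^{\rm ch}$ relative to $\mathbf{p}\cup\mathbf{q}$, where $\otimes$ is any fuzzy conjunction.
   Context: A fuzzy propositional signature $\sigma$ is a set of symbols (fuzzy atoms). Fuzzy formulas of $\sigma$ are built from atoms of $\sigma$ and numeric constants $c\in[0,1]$ using fuzzy negation symbols $\neg$ (unary) and fuzzy conjunction symbols $\otimes$, disjunction symbols $\oplus$ and implication symbols $\rightarrow$ (binary); a formula may use several different operators of each kind. Each symbol is identified with a function $[0,1]\to[0,1]$ (resp. $[0,1]^2\to[0,1]$), where "increasing/decreasing" is non-strict: $\neg$ is decreasing with $\neg(0)=1$, $\neg(1)=0$; $\otimes$ is increasing in both arguments, commutative, associative, $\otimes(1,x)=x$; $\oplus$ is increasing in both arguments, commutative, associative, $\oplus(0,x)=x$; $\rightarrow$ is decreasing in its first and increasing in its second argument, $\rightarrow\!(1,x)=x$ for all $x$, and $\rightarrow\!(0,0)=1$. Particular operators: $\otimes_m(x,y)=\min(x,y)$, $\oplus_l(x,y)=\min(x+y,1)$,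 $\neg_s(x)=1-x$. An interpretation of $\sigma$ is a map $I:\sigma\to[0,1]$. The truth value $\upsilon_I(F)$ is defined by $\upsilon_I(p)=I(p)$, $\upsilon_I(c)=c$, $\upsilon_I(\neg F)=\neg(\upsilon_I(F))$, $\upsilon_I(F\odot G)=\odot(\upsilon_I(F),\upsilon_I(G))$ for $\odot\in\{\otimes,\oplus,\rightarrow\}$. The reduct $F^I$ of $F$ relative to $I$ is defined recursively: $F^I=F$ if $F$ is an atom or a numeric constant; $(\neg F)^I=\upsilon_I(\neg F)$ (a numeric constant); $(F\odot G)^I=(F^I\odot G^I)\otimes_m\upsilon_I(F\odot G)$ for $\odot\in\{\otimes,\oplus,\rightarrow\}$. For $\mathbf{p}\subseteq\sigma$, $J<^{\mathbf{p}}I$ means $J\ne I$, $J(p)=I(p)$ for all atoms $p\notin\mathbf{p}$, and $J(p)\le I(p)$ for all $p\in\mathbf{p}$. For $y\in[0,1]$, $I\models_y F$ means $\upsilon_I(F)\ge y$. $I$ is a $y$-stable model of $F$ relative to $\mathbf{p}$ if $I\models_y F$ and there is no interpretation $J$ with $J<^{\mathbf{p}}I$ and $J\models_y F^I$. For a finite set of atoms $\mathbf{q}=\{q_1,\dots,q_n\}$, the choice formula $\mathbf{q}^{\rm ch}$ is $(q_1\oplus_l\neg_s q_1)\otimes\dots\otimes(q_n\oplus_l\neg_s q_n)$, where $\otimes$ is any fuzzy conjunction.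
   Formalization: In part (b) the "if" direction is stated only for disjoint p and q; it fails otherwise (e.g. p = q = {a}, F = 1, I(a) = 1). Part (a) and the "only if" direction of (b) hold for all p and q. *)

theory Defs
  imports Complex_Main "HOL-Library.FuncSet"
begin

text \<open>
  Truth values are reals in the unit interval. Operators are functions on all reals, but only
  their behaviour on the unit interval is constrained or ever used.
\<close>

definition fuzzy_negation :: "(real \<Rightarrow> real) \<Rightarrow> bool" where
  "fuzzy_negation n \<longleftrightarrow>
     n \<in> {0..1} \<rightarrow> {0..1} \<and> antimono_on {0..1} n \<and> n 0 = 1 \<and> n 1 = 0"

definition fuzzy_conjunction :: "(real \<Rightarrow> real \<Rightarrow> real) \<Rightarrow> bool" where
  "fuzzy_conjunction c \<longleftrightarrow>
     c \<in> {0..1} \<rightarrow> {0..1} \<rightarrow> {0..1} \<and>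
     (\<forall>x\<in>{0..1}. mono_on {0..1} (\<lambda>y. c x y)) \<and>
     (\<forall>y\<in>{0..1}. mono_on {0..1} (\<lambda>x. c x y)) \<and>
     (\<forall>x\<in>{0..1}. \<forall>y\<in>{0..1}. c x y = c y x) \<and>
     (\<forall>x\<in>{0..1}. \<forall>y\<in>{0..1}. \<forall>z\<in>{0..1}. c (c x y) z = c x (c y z)) \<and>
     (\<forall>x\<in>{0..1}. c 1 x = x)"

definition fuzzy_disjunction :: "(real \<Rightarrow> real \<Rightarrow> real) \<Rightarrow> bool" where
  "fuzzy_disjunction d \<longleftrightarrow>
     d \<in> {0..1} \<rightarrow> {0..1} \<rightarrow> {0..1} \<and>
     (\<forall>x\<in>{0..1}. mono_on {0..1} (\<lambda>y. d x y)) \<and>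
     (\<forall>y\<in>{0..1}. mono_on {0..1} (\<lambda>x. d x y)) \<and>
     (\<forall>x\<in>{0..1}. \<forall>y\<in>{0..1}. d x y = d y x) \<and>
     (\<forall>x\<in>{0..1}. \<forall>y\<in>{0..1}. \<forall>z\<in>{0..1}. d (d x y) z = d x (d y z)) \<and>
     (\<forall>x\<in>{0..1}. d 0 x = x)"

definition fuzzy_implication :: "(real \<Rightarrow> real \<Rightarrow> real) \<Rightarrow> bool" where
  "fuzzy_implication i \<longleftrightarrow>
     i \<in> {0..1} \<rightarrow> {0..1} \<rightarrow> {0..1} \<and>
     (\<forall>y\<in>{0..1}. antimono_on {0..1} (\<lambda>x. i x y)) \<and>
     (\<forall>x\<in>{0..1}. mono_on {0..1} (\<lambda>y. i x y)) \<and>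
     (\<forall>x\<in>{0..1}. i 1 x = x) \<and> i 0 0 = 1"

definition conj_m :: "real \<Rightarrow> real \<Rightarrow> real" where
  "conj_m x y = min x y"

definition disj_l :: "real \<Rightarrow> real \<Rightarrow> real" where
  "disj_l x y = min (x + y) 1"

definition neg_s :: "real \<Rightarrow> real" where
  "neg_s x = 1 - x"

lemma fuzzy_conjunction_conj_m: "fuzzy_conjunction conj_m"
  by (auto simp: fuzzy_conjunction_def conj_m_def min_def monotone_on_def)

lemma fuzzy_disjunction_disj_l: "fuzzy_disjunction disj_l"
  by (auto simp: fuzzy_disjunction_def disj_l_def min_def monotone_on_def)

lemma fuzzy_negation_neg_s: "fuzzy_negation neg_s"
  by (auto simp: fuzzy_negation_def neg_s_def monotone_on_def)

text \<open>Operator symbols are identified with the functions they denote, so they are stored in the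
  syntax tree; \<open>formula_of\<close> restricts to legitimate operators, constants and atoms.\<close>

datatype 'a fuzzy_formula =
    Atom 'a
  | Const real
  | Neg "real \<Rightarrow> real" "'a fuzzy_formula"
  | Conj "real \<Rightarrow> real \<Rightarrow> real" "'a fuzzy_formula" "'a fuzzy_formula"
  | Disj "real \<Rightarrow> real \<Rightarrow> real" "'a fuzzy_formula" "'a fuzzy_formula"
  | Impl "real \<Rightarrow> real \<Rightarrow> real" "'a fuzzy_formula" "'a fuzzy_formula"

primrec formula_of :: "'a set \<Rightarrow> 'a fuzzy_formula \<Rightarrow> bool" where
  "formula_of \<sigma> (Atom a) \<longleftrightarrow> a \<in> \<sigma>"
| "formula_of \<sigma> (Const c) \<longleftrightarrow> c \<in> {0..1}"
| "formula_of \<sigma> (Neg n F) \<longleftrightarrow> fuzzy_negation n \<and> formula_of \<sigma> F"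
| "formula_of \<sigma> (Conj c F G) \<longleftrightarrow> fuzzy_conjunction c \<and> formula_of \<sigma> F \<and> formula_of \<sigma> G"
| "formula_of \<sigma> (Disj d F G) \<longleftrightarrow> fuzzy_disjunction d \<and> formula_of \<sigma> F \<and> formula_of \<sigma> G"
| "formula_of \<sigma> (Impl i F G) \<longleftrightarrow> fuzzy_implication i \<and> formula_of \<sigma> F \<and> formula_of \<sigma> G"

text \<open>Extensional functions are used so that equality of interpretations is agreement on the
  signature.\<close>

definition interpretations :: "'a set \<Rightarrow> ('a \<Rightarrow> real) set" where
  "interpretations \<sigma> = \<sigma> \<rightarrow>\<^sub>E {0..1}"

primrec truth_value :: "('a \<Rightarrow> real) \<Rightarrow> 'a fuzzy_formula \<Rightarrow> real" where
  "truth_value I (Atom a) = I a"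
| "truth_value I (Const c) = c"
| "truth_value I (Neg n F) = n (truth_value I F)"
| "truth_value I (Conj c F G) = c (truth_value I F) (truth_value I G)"
| "truth_value I (Disj d F G) = d (truth_value I F) (truth_value I G)"
| "truth_value I (Impl i F G) = i (truth_value I F) (truth_value I G)"

primrec reduct :: "('a \<Rightarrow> real) \<Rightarrow> 'a fuzzy_formula \<Rightarrow> 'a fuzzy_formula" where
  "reduct I (Atom a) = Atom a"
| "reduct I (Const c) = Const c"
| "reduct I (Neg n F) = Const (truth_value I (Neg n F))"
| "reduct I (Conj c F G) =
     Conj conj_m (Conj c (reduct I F) (reduct I G)) (Const (truth_value I (Conj c F G)))"
| "reduct I (Disj d F G) =
     Conj conj_m (Disj d (reduct I F) (reduct I G)) (Const (truth_value I (Disj d F G)))"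
| "reduct I (Impl i F G) =
     Conj conj_m (Impl i (reduct I F) (reduct I G)) (Const (truth_value I (Impl i F G)))"

definition smaller_on :: "'a set \<Rightarrow> 'a set \<Rightarrow> ('a \<Rightarrow> real) \<Rightarrow> ('a \<Rightarrow> real) \<Rightarrow> bool" where
  "smaller_on \<sigma> p J I \<longleftrightarrow> J \<noteq> I \<and> (\<forall>a\<in>\<sigma> - p. J a = I a) \<and> (\<forall>a\<in>p. J a \<le> I a)"

definition satisfies :: "real \<Rightarrow> ('a \<Rightarrow> real) \<Rightarrow> 'a fuzzy_formula \<Rightarrow> bool" where
  "satisfies y I F \<longleftrightarrow> truth_value I F \<ge> y"

definition stable_model ::
    "'a set \<Rightarrow> real \<Rightarrow> 'a fuzzy_formula \<Rightarrow> 'a set \<Rightarrow> ('a \<Rightarrow> real) \<Rightarrow> bool" where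
  "stable_model \<sigma> y F p I \<longleftrightarrow>
     I \<in> interpretations \<sigma> \<and> satisfies y I F \<and>
     \<not> (\<exists>J\<in>interpretations \<sigma>. smaller_on \<sigma> p J I \<and> satisfies y J (reduct I F))"

definition choice_atom :: "'a \<Rightarrow> 'a fuzzy_formula" where
  "choice_atom a = Disj disj_l (Atom a) (Neg neg_s (Atom a))"

text \<open>The choice formula of a finite set is formed from an enumeration of the set. The conjunction
  is left-nested; the empty conjunction is the constant 1, the neutral element of every fuzzy
  conjunction. An atom in both \<open>p\<close> and \<open>q\<close> may
  decrease when minimizing on \<open>p\<close>, but the choice formula of \<open>q\<close> keeps it fixed; so equivalences
  between the two notions of stability need \<open>p \<inter> q = {}\<close> in one direction.\<close>

fun choice_formula :: "(real \<Rightarrow> real \<Rightarrow> real) \<Rightarrow> 'a list \<Rightarrow> 'a fuzzy_formula" where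
  "choice_formula c [] = Const 1"
| "choice_formula c (a # as) = foldl (Conj c) (choice_atom a) (map choice_atom as)"

end

theory Submission
  imports Defs
begin

text \<open>A fuzzy conjunction takes the value 1 only if both arguments do, so at threshold 1 it behaves
  like classical conjunction. At \<open>J\<close>, the reduct relative to \<open>I\<close> of the choice formula of \<open>a\<close> is worth
  \<open>min (J a + 1 - I a) 1\<close>, which equals 1 exactly if \<open>I a \<le> J a\<close>; the choice formula
  thus pins the atoms of \<open>q\<close> to their values under \<open>I\<close>.\<close>

lemma fuzzy_conjunction_ge_one_iff:
  assumes c: "fuzzy_conjunction c" and x: "x \<in> {0..1}" and y: "y \<in> {0..1}"
  shows "1 \<le> c x y \<longleftrightarrow> 1 \<le> x \<and> 1 \<le> y"
proof -
  have one: "c 1 z = z" if "z \<in> {0..1}" for z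
    using c that by (simp add: fuzzy_conjunction_def)
  \<comment> \<open>Monotonicity compares \<open>v\<close> with the neutral element 1, moved to the
    left by commutativity: \<open>c u v \<le> c u 1 = c 1 u = u\<close>.\<close>
  have bound: "c u v \<le> u" if uv: "u \<in> {0..1}" "v \<in> {0..1}" for u v
  proof -
    have "mono_on {0..1} (c u)" "c u 1 = c 1 u"
      using c uv by (simp_all add: fuzzy_conjunction_def)
    then have "c u v \<le> c 1 u"
      using monotone_onD[of "{0..1}" "(\<le>)" "(\<le>)" "c u" v 1] uv by simp
    then show ?thesis using one[OF uv(1)] by simp
  qed
  have "c x y = c y x"
    using c x y unfolding fuzzy_conjunction_def by blast
  with bound[OF x y] bound[OF y x] have "c x y \<le> x" "c x y \<le> y"
    by simp_all
  moreover have "c x y = 1" if "1 \<le> x" "1 \<le> y"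
    using that x y one[of 1] by (simp add: order_antisym_conv)
  ultimately show ?thesis by force
qed

text \<open>The operator laws hold only on \<open>{0..1}\<close>, so every later appeal to them
  passes through this closure property.\<close>

lemma truth_value_in_unit_interval:
  assumes "formula_of \<sigma> F" and "I \<in> interpretations \<sigma>"
  shows "truth_value I F \<in> {0..1}"
  using assms
proof (induction F)
  case (Atom a)
  then have "I a \<in> {0..1}"
    unfolding interpretations_def formula_of.simps by (rule PiE_mem[rotated])
  then show ?case by simp
next
  case (Const x)
  then show ?case by simp
next
  case (Neg n F)
  then have "n \<in> {0..1} \<rightarrow> {0..1}" "truth_value I F \<in> {0..1}"
    by (simp_all add: fuzzy_negation_def)
  then show ?case unfolding truth_value.simps by (rule funcset_mem)
next
  case (Conj c F G)
  then have "c \<in> {0..1} \<rightarrow> {0..1} \<rightarrow> {0..1}" "truth_value I F \<in> {0..1}" "truth_value I G \<in> {0..1}"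
    by (simp_all add: fuzzy_conjunction_def)
  then show ?case unfolding truth_value.simps by (blast dest: funcset_mem)
next
  case (Disj d F G)
  then have "d \<in> {0..1} \<rightarrow> {0..1} \<rightarrow> {0..1}" "truth_value I F \<in> {0..1}" "truth_value I G \<in> {0..1}"
    by (simp_all add: fuzzy_disjunction_def)
  then show ?case unfolding truth_value.simps by (blast dest: funcset_mem)
next
  case (Impl i F G)
  then have "i \<in> {0..1} \<rightarrow> {0..1} \<rightarrow> {0..1}" "truth_value I F \<in> {0..1}" "truth_value I G \<in> {0..1}"
    by (simp_all add: fuzzy_implication_def)
  then show ?case unfolding truth_value.simps by (blast dest: funcset_mem)
qed

text \<open>The reduct introduces only truth values as new constants and \<open>conj_m\<close> as a
  new operator, all of them legitimate; facts about formulas can thus be applied to reducts.\<close>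

lemma formula_of_reduct:
  assumes "formula_of \<sigma> F" and "I \<in> interpretations \<sigma>"
  shows "formula_of \<sigma> (reduct I F)"
  using assms
proof (induction F)
  case (Neg n F)
  then show ?case using truth_value_in_unit_interval[of \<sigma> "Neg n F" I] by simp
next
  case (Conj c F G)
  then show ?case
    using truth_value_in_unit_interval[of \<sigma> "Conj c F G" I] fuzzy_conjunction_conj_m by simp
next
  case (Disj d F G)
  then show ?case
    using truth_value_in_unit_interval[of \<sigma> "Disj d F G" I] fuzzy_conjunction_conj_m by simp
next
  case (Impl i F G)
  then show ?case
    using truth_value_in_unit_interval[of \<sigma> "Impl i F G" I] fuzzy_conjunction_conj_m by simp
qed simp_all

lemma satisfies_one_Conj_iff:
  assumes "formula_of \<sigma> (Conj c F G)" and "I \<in> interpretations \<sigma>"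
  shows "satisfies 1 I (Conj c F G) \<longleftrightarrow> satisfies 1 I F \<and> satisfies 1 I G"
proof -
  have "truth_value I F \<in> {0..1}" "truth_value I G \<in> {0..1}" "fuzzy_conjunction c"
    using assms truth_value_in_unit_interval by auto
  then show ?thesis by (simp add: satisfies_def fuzzy_conjunction_ge_one_iff)
qed

text \<open>The reduct of a conjunction is capped by the value of the conjunction under
  \<open>I\<close>. When \<open>I\<close> satisfies it at threshold 1, the cap has no effect and
  only the conjunction of the two reducts remains.\<close>

lemma satisfies_one_reduct_Conj_iff:
  assumes "formula_of \<sigma> (Conj c F G)" and "I \<in> interpretations \<sigma>" and "J \<in> interpretations \<sigma>"
    and "satisfies 1 I (Conj c F G)"
  shows "satisfies 1 J (reduct I (Conj c F G)) \<longleftrightarrow>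
    satisfies 1 J (reduct I F) \<and> satisfies 1 J (reduct I G)"
proof -
  have "formula_of \<sigma> (Conj c (reduct I F) (reduct I G))"
    using assms formula_of_reduct by auto
  from satisfies_one_Conj_iff[OF this assms(3)] show ?thesis
    using assms(4) by (simp add: satisfies_def conj_m_def)
qed

lemma formula_of_choice_atom: "formula_of \<sigma> (choice_atom a) \<longleftrightarrow> a \<in> \<sigma>"
  by (simp add: choice_atom_def fuzzy_disjunction_disj_l fuzzy_negation_neg_s)

lemma satisfies_choice_atom: "satisfies 1 I (choice_atom a)"
  by (simp add: satisfies_def choice_atom_def disj_l_def neg_s_def)

text \<open>In the reduct the negated atom is frozen at \<open>1 - I a\<close> while the positive
  atom is read under \<open>J\<close>; the outer cap is 1.\<close>

lemma satisfies_reduct_choice_atom_iff: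
  "satisfies 1 J (reduct I (choice_atom a)) \<longleftrightarrow> I a \<le> J a"
  by (simp add: satisfies_def choice_atom_def disj_l_def neg_s_def conj_m_def)

text \<open>Induction on the list with an arbitrary accumulator \<open>G\<close>. The three claims
  go together because splitting the reduct at each step requires the new accumulator to be well
  formed and satisfied by \<open>I\<close>.\<close>

lemma foldl_Conj_choice_atom:
  assumes "fuzzy_conjunction d" and "set as \<subseteq> \<sigma>" and "formula_of \<sigma> G" and "satisfies 1 I G"
    and "I \<in> interpretations \<sigma>"
  defines "H \<equiv> foldl (Conj d) G (map choice_atom as)"
  shows "formula_of \<sigma> H \<and> satisfies 1 I H \<and>
    (\<forall>J\<in>interpretations \<sigma>. satisfies 1 J (reduct I H) \<longleftrightarrow>
       satisfies 1 J (reduct I G) \<and> (\<forall>a\<in>set as. I a \<le> J a))"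
  using assms(2-4) unfolding H_def
proof (induction as arbitrary: G)
  case Nil
  then show ?case by simp
next
  case (Cons a as)
  let ?G = "Conj d G (choice_atom a)"
  have f: "formula_of \<sigma> ?G"
    using Cons.prems assms(1) by (simp add: formula_of_choice_atom)
  have s: "satisfies 1 I ?G"
    using Cons.prems satisfies_choice_atom[of I a] by (simp only: satisfies_one_Conj_iff[OF f assms(5)])
  have "satisfies 1 J (reduct I ?G) \<longleftrightarrow> satisfies 1 J (reduct I G) \<and> I a \<le> J a"
    if "J \<in> interpretations \<sigma>" for J
    using satisfies_one_reduct_Conj_iff[OF f assms(5) that s] satisfies_reduct_choice_atom_iff
    by metis
  with Cons.IH[OF _ f s] Cons.prems(1) show ?case
    by (simp del: reduct.simps)
qed

lemma choice_formula:
  assumes "fuzzy_conjunction d" and "set as \<subseteq> \<sigma>" and "I \<in> interpretations \<sigma>"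
  shows formula_of_choice_formula: "formula_of \<sigma> (choice_formula d as)"
    and satisfies_choice_formula: "satisfies 1 I (choice_formula d as)"
    and satisfies_reduct_choice_formula_iff: "J \<in> interpretations \<sigma> \<Longrightarrow>
      satisfies 1 J (reduct I (choice_formula d as)) \<longleftrightarrow> (\<forall>a\<in>set as. I a \<le> J a)"
proof -
  have "formula_of \<sigma> (choice_formula d as) \<and> satisfies 1 I (choice_formula d as) \<and>
    (\<forall>J\<in>interpretations \<sigma>.
       satisfies 1 J (reduct I (choice_formula d as)) \<longleftrightarrow> (\<forall>a\<in>set as. I a \<le> J a))"
  \<comment> \<open>The fold starts from the first choice atom, which serves as the initial
    accumulator; the empty list yields the constant 1, which is its own reduct and constrains
    nothing.\<close>
  proof (cases as)
    case Nil
    then show ?thesis by (simp add: satisfies_def)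
  next
    case (Cons a bs)
    then show ?thesis
      using foldl_Conj_choice_atom[of d bs \<sigma> "choice_atom a" I] assms
      by (simp add: formula_of_choice_atom satisfies_choice_atom satisfies_reduct_choice_atom_iff)
  qed
  then show "formula_of \<sigma> (choice_formula d as)" "satisfies 1 I (choice_formula d as)"
    "J \<in> interpretations \<sigma> \<Longrightarrow>
      satisfies 1 J (reduct I (choice_formula d as)) \<longleftrightarrow> (\<forall>a\<in>set as. I a \<le> J a)"
    by blast+
qed

text \<open>Atoms of \<open>q\<close> outside \<open>p\<close> keep their values, so the inequality
  holds there too. Minimizing on a larger set only admits more competitors, which gives part
  (a).\<close>

lemma smaller_on_Un:
  assumes "smaller_on \<sigma> p J I" and "q \<subseteq> \<sigma>"
  shows "smaller_on \<sigma> (p \<union> q) J I"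
proof -
  have "J a \<le> I a" if "a \<in> p \<union> q" for a
    using assms that unfolding smaller_on_def by (cases "a \<in> p") auto
  with assms show ?thesis unfolding smaller_on_def by blast
qed

text \<open>On \<open>q\<close> the lower bound meets the upper bound from
  \<open>smaller_on\<close>, so only atoms of \<open>p\<close> can differ.\<close>

lemma smaller_on_if_smaller_on_Un:
  assumes "smaller_on \<sigma> (p \<union> q) J I" and "\<forall>a\<in>q. I a \<le> J a"
  shows "smaller_on \<sigma> p J I"
proof -
  have "J a = I a" if "a \<in> \<sigma> - p" for a
    using assms that unfolding smaller_on_def by (cases "a \<in> q") (auto intro: order_antisym)
  with assms show ?thesis unfolding smaller_on_def by blast
qed

lemma smaller_on_imp_ge_outside:
  assumes "smaller_on \<sigma> p J I" and "p \<inter> q = {}" and "q \<subseteq> \<sigma>"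
  shows "\<forall>a\<in>q. I a \<le> J a"
proof
  fix a assume "a \<in> q"
  then have "a \<in> \<sigma> - p" using assms(2,3) by blast
  then show "I a \<le> J a" using assms(1) by (simp add: smaller_on_def)
qed

theorem theorem9:
  fixes \<sigma> p q :: "'a set" and F :: "'a fuzzy_formula" and I :: "'a \<Rightarrow> real"
  assumes "formula_of \<sigma> F" and "I \<in> interpretations \<sigma>" and "p \<subseteq> \<sigma>" and "q \<subseteq> \<sigma>"
  shows "(\<forall>y\<in>{0..1}. stable_model \<sigma> y F (p \<union> q) I \<longrightarrow> stable_model \<sigma> y F p I) \<and>
    (\<forall>c d qs. fuzzy_conjunction c \<and> fuzzy_conjunction d \<and> distinct qs \<and> set qs = q \<longrightarrow>
       (stable_model \<sigma> 1 F p I \<longrightarrow>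
          stable_model \<sigma> 1 (Conj c F (choice_formula d qs)) (p \<union> q) I) \<and>
       (p \<inter> q = {} \<longrightarrow>
          (stable_model \<sigma> 1 F p I \<longleftrightarrow>
           stable_model \<sigma> 1 (Conj c F (choice_formula d qs)) (p \<union> q) I)))"
proof (intro conjI ballI allI impI; (elim conjE)?)
  fix y :: real
  assume "stable_model \<sigma> y F (p \<union> q) I"
  then show "stable_model \<sigma> y F p I"
    using smaller_on_Un[OF _ assms(4)] unfolding stable_model_def by blast
next
  fix c d qs
  assume cd: "fuzzy_conjunction c" "fuzzy_conjunction d" and q: "set qs = q"
  let ?C = "choice_formula d qs"
  have qs: "set qs \<subseteq> \<sigma>" using q assms(4) by simp
  have f: "formula_of \<sigma> (Conj c F ?C)"
    using assms(1) cd(1) formula_of_choice_formula[OF cd(2) qs assms(2)] by simp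
  have sat: "satisfies 1 I (Conj c F ?C) \<longleftrightarrow> satisfies 1 I F"
    using satisfies_one_Conj_iff[OF f assms(2)] satisfies_choice_formula[OF cd(2) qs assms(2)]
    by blast
  \<comment> \<open>By \<open>sat\<close>, the assumption on \<open>F\<close> makes \<open>I\<close>
    satisfy the whole conjunction, so its reduct splits; the choice part becomes the lower bound on
    \<open>q\<close>.\<close>
  have red: "satisfies 1 J (reduct I (Conj c F ?C)) \<longleftrightarrow>
      satisfies 1 J (reduct I F) \<and> (\<forall>a\<in>q. I a \<le> J a)"
    if "J \<in> interpretations \<sigma>" "satisfies 1 I F" for J
    using satisfies_one_reduct_Conj_iff[OF f assms(2) that(1)] sat that(2)
      satisfies_reduct_choice_formula_iff[OF cd(2) qs assms(2) that(1)] q by blast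
  \<comment> \<open>A competitor on \<open>p \<union> q\<close> for the conjunction is bounded below
    by \<open>I\<close> on \<open>q\<close>, hence is already a competitor on \<open>p\<close> for
    \<open>F\<close>.\<close>
  show imp: "stable_model \<sigma> 1 (Conj c F ?C) (p \<union> q) I" if "stable_model \<sigma> 1 F p I"
    using that sat red smaller_on_if_smaller_on_Un[of \<sigma> p q _ I] unfolding stable_model_def
    by metis
  assume disj: "p \<inter> q = {}"
  \<comment> \<open>Conversely, by disjointness a competitor on \<open>p\<close> for
    \<open>F\<close> agrees with \<open>I\<close> on \<open>q\<close>; it therefore satisfies the
    choice part as well and competes on \<open>p \<union> q\<close>.\<close>
  have "stable_model \<sigma> 1 F p I" if "stable_model \<sigma> 1 (Conj c F ?C) (p \<union> q) I"
    using that sat red smaller_on_Un[OF _ assms(4)] smaller_on_imp_ge_outside[OF _ disj assms(4)]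
    unfolding stable_model_def by metis
  with imp show "stable_model \<sigma> 1 F p I \<longleftrightarrow> stable_model \<sigma> 1 (Conj c F ?C) (p \<union> q) I"
    by blast
qed

end
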